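(* Let $f,g:[0,+\infty)\to[0,+\infty)$ be synchronous functions. Then $$f\left(s_j(A)\right)g\left(s_j(A)\right)+s_j\left(f(B)g(B)\right)\geq f\left(s_j(A)\right)s_n\left(g(B)\right)+s_j\left(f(B)\right)g\left(s_j(A)\right)$$ for all positive semidefinite matrices $A,B\in\mathbb{M}_n$ and all $j=1,2,\dots,n$.
   Context: $\mathbb{M}_n$ is the algebra of complex $n\times n$ matrices. $s_1(A)\ge\cdots\ge s_n(A)$ are the singular values of $A$, i.e. the eigenvalues of $|A|=(A^*A)^{1/2}$ counted with multiplicity. Two continuous functions $f,g$ on an interval $J$ are synchronous if $(f(t)-f(s))(g(t)-g(s))\ge 0$ for all $s,t\in J$. $f(B)$ denotes the functional calculus. *)

theory Defs
  imports "Jordan_Normal_Form.Schur_Decomposition"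
begin

definition synchronous_on :: "real set \<Rightarrow> (real \<Rightarrow> real) \<Rightarrow> (real \<Rightarrow> real) \<Rightarrow> bool" where
  "synchronous_on J f g \<longleftrightarrow> continuous_on J f \<and> continuous_on J g \<and>
     (\<forall>s\<in>J. \<forall>t\<in>J. (f t - f s) * (g t - g s) \<ge> 0)"

(* The order on complex numbers is that of HOL-Library.Complex_Order:
   0 \<le> z means that z is real and nonnegative. *)
definition positive_semidefinite :: "nat \<Rightarrow> complex mat \<Rightarrow> bool" where
  "positive_semidefinite n A \<longleftrightarrow> A \<in> carrier_mat n n \<and> mat_adjoint A = A \<and>
     (\<forall>x\<in>carrier_vec n. 0 \<le> (A *\<^sub>v x) \<bullet>c x)"

definition unitary_mat :: "nat \<Rightarrow> complex mat \<Rightarrow> bool" where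
  "unitary_mat n U \<longleftrightarrow> U \<in> carrier_mat n n \<and>
     mat_adjoint U * U = 1\<^sub>m n \<and> U * mat_adjoint U = 1\<^sub>m n"

definition spectral_decomposition ::
    "complex mat \<Rightarrow> complex mat \<Rightarrow> (nat \<Rightarrow> real) \<Rightarrow> bool" where
  "spectral_decomposition A U d \<longleftrightarrow> unitary_mat (dim_row A) U \<and>
     A = U * mat_diag (dim_row A) (\<lambda>i. complex_of_real (d i)) * mat_adjoint U"

(* Functional calculus for Hermitian A: if A = U diag(d) U^* then f(A) = U diag(f o d) U^*.
   The matrix f(A) does not depend on the choice of U and d (lemma mat_fun_eq below). *)
definition mat_fun :: "(real \<Rightarrow> real) \<Rightarrow> complex mat \<Rightarrow> complex mat" where
  "mat_fun f A = (THE C. \<exists>U d. spectral_decomposition A U d \<and>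
     C = U * mat_diag (dim_row A) (\<lambda>i. complex_of_real (f (d i))) * mat_adjoint U)"

definition mat_abs :: "complex mat \<Rightarrow> complex mat" where
  "mat_abs A = mat_fun sqrt (mat_adjoint A * A)"

(* The j-th largest singular value, for j = 1, ..., n. The multiset proots lists the roots of the
   characteristic polynomial with multiplicity; they are real for the Hermitian matrix |A|,
   so Re only changes their type. *)
definition singular_value :: "complex mat \<Rightarrow> nat \<Rightarrow> real" where
  "singular_value A j =
     rev (sorted_list_of_multiset (image_mset Re (proots (char_poly (mat_abs A))))) ! (j - 1)"

lemma mat_adjoint_carrier: "U \<in> carrier_mat n m \<Longrightarrow> mat_adjoint U \<in> carrier_mat m n"
  unfolding mat_adjoint_def mat_of_rows_def by (intro carrier_matI) simp_all

lemma spectral_decomposition_unique: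
  assumes U: "spectral_decomposition A U d" and V: "spectral_decomposition A V e"
  shows "U * mat_diag (dim_row A) (\<lambda>i. complex_of_real (f (d i))) * mat_adjoint U =
         V * mat_diag (dim_row A) (\<lambda>i. complex_of_real (f (e i))) * mat_adjoint V"
proof -
  define n where "n = dim_row A"
  define D where "D = (\<lambda>h::nat \<Rightarrow> real. mat_diag n (\<lambda>i. complex_of_real (h i)))"
  define U' V' where "U' = mat_adjoint U" and "V' = mat_adjoint V"
  have D[simp]: "D h \<in> carrier_mat n n" for h by (simp add: D_def)
  have UA: "unitary_mat n U \<and> A = U * D d * U'"
    using U unfolding spectral_decomposition_def n_def D_def U'_def .
  have VA: "unitary_mat n V \<and> A = V * D e * V'"
    using V unfolding spectral_decomposition_def n_def D_def V'_def .
  have U0: "U \<in> carrier_mat n n" "U' * U = 1\<^sub>m n" "U * U' = 1\<^sub>m n"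
    using UA[THEN conjunct1] unfolding unitary_mat_def U'_def by simp_all
  have V0: "V \<in> carrier_mat n n" "V' * V = 1\<^sub>m n" "V * V' = 1\<^sub>m n"
    using VA[THEN conjunct1] unfolding unitary_mat_def V'_def by simp_all
  have C[simp]: "U \<in> carrier_mat n n" "V \<in> carrier_mat n n"
      "U' \<in> carrier_mat n n" "V' \<in> carrier_mat n n"
    unfolding U'_def V'_def by (fact U0(1) V0(1) mat_adjoint_carrier[OF U0(1)]
      mat_adjoint_carrier[OF V0(1)])+
  have M[simp]: "X * Y \<in> carrier_mat n n"
    if "X \<in> carrier_mat n n" "Y \<in> carrier_mat n n" for X Y :: "complex mat"
    using that by (rule mult_carrier_mat)
  note assoc = assoc_mult_mat[of _ n n _ n _ n]
  define W where "W = V' * U"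
  have W[simp]: "W \<in> carrier_mat n n" unfolding W_def by simp
  have "W * D d = V' * (U * D d * U') * U"
    unfolding W_def by (simp add: assoc U0(2) right_mult_one_mat[OF D])
  also have "\<dots> = V' * (V * D e * V') * U" unfolding UA[THEN conjunct2, symmetric] VA[THEN conjunct2, symmetric] ..
  also have "\<dots> = (V' * V) * (D e * (V' * U))" by (simp add: assoc)
  also have "\<dots> = D e * W" unfolding V0(2) W_def by (intro left_mult_one_mat[of _ n n]) simp
  finally have eq: "W * D d = D e * W" .
  have L: "D h * W = mat n n (\<lambda>(i,j). complex_of_real (h i) * W $$ (i,j))" for h
    unfolding D_def by (rule mat_diag_mult_left[OF W])
  have R: "W * D h = mat n n (\<lambda>(i,j). W $$ (i,j) * complex_of_real (h j))" for h
    unfolding D_def by (rule mat_diag_mult_right[OF W])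
  have entry: "W $$ (i,j) * complex_of_real (f (d j)) = complex_of_real (f (e i)) * W $$ (i,j)"
    if "i < n" "j < n" for i j
  proof -
    have "W $$ (i,j) * complex_of_real (d j) = complex_of_real (e i) * W $$ (i,j)"
      using arg_cong[OF eq, of "\<lambda>M. M $$ (i,j)"] that unfolding L R by simp
    then have "W $$ (i,j) = 0 \<or> d j = e i" by simp
    then show ?thesis by auto
  qed
  have eqf: "W * D (\<lambda>i. f (d i)) = D (\<lambda>i. f (e i)) * W"
    unfolding L R by (rule cong_mat) (simp_all add: entry)
  have "U * D (\<lambda>i. f (d i)) * U' = (V * V') * U * D (\<lambda>i. f (d i)) * U'"
    unfolding V0(3) by (simp add: left_mult_one_mat[OF C(1)])
  also have "\<dots> = V * (W * D (\<lambda>i. f (d i))) * U'"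
    unfolding W_def by (simp add: assoc)
  also have "\<dots> = V * (D (\<lambda>i. f (e i)) * W) * U'" unfolding eqf ..
  also have "\<dots> = V * D (\<lambda>i. f (e i)) * V' * (U * U')"
    unfolding W_def by (simp add: assoc)
  also have "\<dots> = V * D (\<lambda>i. f (e i)) * V'" unfolding U0(3) by (intro right_mult_one_mat[of _ n n]) simp
  finally show ?thesis unfolding D_def n_def U'_def V'_def .
qed

lemma mat_fun_eq:
  assumes "spectral_decomposition A U d"
  shows "mat_fun f A =
    U * mat_diag (dim_row A) (\<lambda>i. complex_of_real (f (d i))) * mat_adjoint U"
  unfolding mat_fun_def
proof (rule the_equality)
  fix C
  assume "\<exists>U d. spectral_decomposition A U d \<and>
    C = U * mat_diag (dim_row A) (\<lambda>i. complex_of_real (f (d i))) * mat_adjoint U"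
  then obtain V e where V: "spectral_decomposition A V e"
    and C: "C = V * mat_diag (dim_row A) (\<lambda>i. complex_of_real (f (e i))) * mat_adjoint V"
    by (elim exE conjE)
  show "C = U * mat_diag (dim_row A) (\<lambda>i. complex_of_real (f (d i))) * mat_adjoint U"
    unfolding C by (rule spectral_decomposition_unique[OF V assms])
qed (rule exI[of _ U], rule exI[of _ d], rule conjI[OF assms refl])

end

theory Submission
  imports Defs
begin

text \<open>
  By the spectral theorem everything reduces to order statistics of the eigenvalues. Put
  \<open>s = s_j(A) \<ge> 0\<close> and let \<open>b_i \<ge> 0\<close> be the eigenvalues of \<open>B\<close>. Synchronicity at \<open>s\<close> and \<open>b_i\<close>,
  together with \<open>g(b_i) \<ge> s_n(g(B))\<close> and \<open>f(s) \<ge> 0\<close>, gives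
  \<open>f(b_i) g(b_i) \<ge> f(b_i) g(s) + f(s) (s_n(g(B)) - g(s))\<close>. The right-hand side is a monotone function
  of \<open>f(b_i)\<close> because \<open>g(s) \<ge> 0\<close>, so the inequality passes to the \<open>j\<close>-th largest values.
\<close>

subsection \<open>Order statistics\<close>

text \<open>Trades an order statistic for a count. In a decreasing list the entries that are at
  least \<open>c\<close> form an initial segment, and the entry at index \<open>j - 1\<close> lies
  in it exactly when the segment has \<open>j\<close> or more members. The count ignores order, so
  it can be taken on the unsorted list.\<close>

lemma le_nth_rev_sort_iff:
  fixes xs :: "'a::linorder list"
  assumes "1 \<le> j" "j \<le> length xs"
  shows "c \<le> rev (sort xs) ! (j - 1) \<longleftrightarrow> j \<le> length (filter (\<lambda>x. c \<le> x) xs)"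
proof -
  define ys where "ys = rev (sort xs)"
  have len: "length ys = length xs" by (simp add: ys_def)
  have anti: "ys ! l \<le> ys ! k" if "k \<le> l" "l < length xs" for k l
  proof -
    have "sorted (rev ys)" by (simp add: ys_def)
    then show ?thesis using that len by (simp add: sorted_rev_nth_mono)
  qed
  have "length (filter (\<lambda>x. c \<le> x) xs) = length (filter (\<lambda>x. c \<le> x) ys)"
    unfolding ys_def size_mset[symmetric] mset_filter by simp
  also have "\<dots> = card {k. k < length xs \<and> c \<le> ys ! k}"
    by (simp add: length_filter_conv_card len)
  finally have eq: "length (filter (\<lambda>x. c \<le> x) xs) = card {k. k < length xs \<and> c \<le> ys ! k}" .
  show ?thesis unfolding eq ys_def[symmetric]
  proof
    assume c: "c \<le> ys ! (j - 1)"
    have "{..<j} \<subseteq> {k. k < length xs \<and> c \<le> ys ! k}"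
    proof
      fix k assume "k \<in> {..<j}"
      then have "k \<le> j - 1" "k < length xs" using assms by auto
      moreover from this have "ys ! (j - 1) \<le> ys ! k" using assms by (intro anti) auto
      ultimately show "k \<in> {k. k < length xs \<and> c \<le> ys ! k}" using c by auto
    qed
    then have "card {..<j} \<le> card {k. k < length xs \<and> c \<le> ys ! k}"
      by (rule card_mono[rotated]) simp
    then show "j \<le> card {k. k < length xs \<and> c \<le> ys ! k}" by simp
  next
    assume j: "j \<le> card {k. k < length xs \<and> c \<le> ys ! k}"
    show "c \<le> ys ! (j - 1)"
    proof (rule ccontr)
      assume nc: "\<not> c \<le> ys ! (j - 1)"
      \<comment> \<open>Once the entry at index \<open>j - 1\<close> is below \<open>c\<close>, so
        are all later ones; only the \<open>j - 1\<close> earlier indices remain.\<close>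
      have "{k. k < length xs \<and> c \<le> ys ! k} \<subseteq> {..<j - 1}"
      proof
        fix k assume "k \<in> {k. k < length xs \<and> c \<le> ys ! k}"
        then show "k \<in> {..<j - 1}"
          using nc anti[of "j - 1" k] order_trans[of c "ys ! k" "ys ! (j - 1)"]
          by (auto simp: not_le[symmetric])
      qed
      then have "card {k. k < length xs \<and> c \<le> ys ! k} \<le> j - 1"
        using card_mono[of "{..<j - 1}"] by fastforce
      then show False using j assms by simp
    qed
  qed
qed

text \<open>The two sorted lists may order the underlying elements differently, so they are compared
  through counts. If \<open>c\<close> is the \<open>j\<close>-th largest value of \<open>h\<close>,
  at least \<open>j\<close> elements satisfy \<open>c \<le> h x\<close>, and each of them satisfies
  \<open>\<phi> c \<le> \<phi> (h x) \<le> k x\<close>.\<close>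

lemma nth_rev_sort_mono:
  fixes h :: "'b \<Rightarrow> 'a::linorder" and k :: "'b \<Rightarrow> 'c::linorder"
  assumes "1 \<le> j" "j \<le> length xs" and "mono \<phi>"
    and "\<And>x. x \<in> set xs \<Longrightarrow> \<phi> (h x) \<le> k x"
  shows "\<phi> (rev (sort (map h xs)) ! (j - 1)) \<le> rev (sort (map k xs)) ! (j - 1)"
proof -
  define c where "c = rev (sort (map h xs)) ! (j - 1)"
  have "j \<le> length (filter (\<lambda>x. c \<le> x) (map h xs))"
    using le_nth_rev_sort_iff[of j "map h xs" c] assms(1,2) by (simp add: c_def)
  also have "\<dots> = length (filter (\<lambda>x. c \<le> h x) xs)" by (simp add: filter_map o_def)
  also have "\<dots> \<le> length (filter (\<lambda>x. \<phi> c \<le> k x) xs)"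
  proof -
    \<comment> \<open>The first condition implies the second on \<open>xs\<close>, so filtering by
      the second one beforehand removes nothing that counts.\<close>
    have "filter (\<lambda>x. c \<le> h x) xs = filter (\<lambda>x. c \<le> h x) (filter (\<lambda>x. \<phi> c \<le> k x) xs)"
      using assms(4) monoD[OF assms(3)] by (auto intro!: filter_cong dest: order_trans)
    then show ?thesis by (metis length_filter_le)
  qed
  also have "\<dots> = length (filter (\<lambda>x. \<phi> c \<le> x) (map k xs))" by (simp add: filter_map o_def)
  finally show ?thesis
    using le_nth_rev_sort_iff[of j "map k xs" "\<phi> c"] assms(1,2) by (simp add: c_def)
qed

lemma nth_rev_sort_mem: "1 \<le> j \<Longrightarrow> j \<le> length xs \<Longrightarrow> rev (sort xs) ! (j - 1) \<in> set xs"
  using nth_mem[of "j - 1" "rev (sort xs)"] by simp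

text \<open>The counting criterion with \<open>j\<close> equal to the length: every entry passes the
  filter, since a single failure would make the filtered list strictly shorter.\<close>

lemma nth_rev_sort_last_le:
  assumes "x \<in> set xs"
  shows "rev (sort xs) ! (length xs - 1) \<le> x"
proof -
  have "1 \<le> length xs" using assms by (cases xs) auto
  then have le: "length xs \<le> length (filter (\<lambda>y. rev (sort xs) ! (length xs - 1) \<le> y) xs)"
    using le_nth_rev_sort_iff[of "length xs" xs] by blast
  show ?thesis
  proof (rule ccontr)
    assume "\<not> ?thesis"
    with length_filter_less[of x xs "\<lambda>y. rev (sort xs) ! (length xs - 1) \<le> y"] assms le
    show False by simp
  qed
qed

subsection \<open>Adjoints and unitary matrices\<close>

lemma mat_adjoint_index [simp]:
  "i < dim_col A \<Longrightarrow> j < dim_row A \<Longrightarrow> mat_adjoint A $$ (i, j) = conjugate (A $$ (j, i))"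
  by (simp add: mat_adjoint_def mat_of_rows_def)

lemma mat_adjoint_dim [simp]:
  "dim_row (mat_adjoint A) = dim_col A" "dim_col (mat_adjoint A) = dim_row A"
  by (simp_all add: mat_adjoint_def mat_of_rows_def)

lemma mat_adjoint_adjoint [simp]: "mat_adjoint (mat_adjoint A) = A"
  by (intro eq_matI) simp_all

lemma row_mat_adjoint:
  "i < dim_col A \<Longrightarrow> row (mat_adjoint A) i = conjugate (col A i)"
  by (intro eq_vecI) simp_all

lemma mat_adjoint_mult:
  assumes "A \<in> carrier_mat n k" "B \<in> carrier_mat k m"
  shows "mat_adjoint (A * B) = mat_adjoint B * mat_adjoint (A :: 'a::conjugatable_field mat)"
proof (intro eq_matI)
  fix i j assume "i < dim_row (mat_adjoint B * mat_adjoint A)"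
    "j < dim_col (mat_adjoint B * mat_adjoint A)"
  then have ij: "i < m" "j < n" using assms by auto
  then show "mat_adjoint (A * B) $$ (i, j) = (mat_adjoint B * mat_adjoint A) $$ (i, j)"
    using assms by (simp add: scalar_prod_def sum_conjugate conjugate_dist_mul mult.commute)
qed (use assms in auto)

lemma unitary_mat_mult:
  assumes U: "unitary_mat n U" and V: "unitary_mat n V"
  shows "unitary_mat n (U * V)"
proof -
  have C: "U \<in> carrier_mat n n" "V \<in> carrier_mat n n"
    "mat_adjoint U \<in> carrier_mat n n" "mat_adjoint V \<in> carrier_mat n n"
    using U V by (auto simp: unitary_mat_def intro: mat_adjoint_carrier)
  have "mat_adjoint (U * V) * (U * V) = mat_adjoint V * ((mat_adjoint U * U) * V)"
    using C by (simp add: mat_adjoint_mult assoc_mult_mat[of _ n n _ n _ n] mult_carrier_mat[of _ n n])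
  also have "\<dots> = 1\<^sub>m n" using U V C by (simp add: unitary_mat_def)
  finally have 1: "mat_adjoint (U * V) * (U * V) = 1\<^sub>m n" .
  moreover have "U * V * mat_adjoint (U * V) = 1\<^sub>m n"
    using C by (intro mat_mult_left_right_inverse[OF _ _ 1]) (auto intro: mat_adjoint_carrier)
  ultimately show ?thesis using C by (auto simp: unitary_mat_def)
qed

text \<open>Complete \<open>v\<close> to a basis, orthogonalise by Gram-Schmidt, which keeps the
  first vector, and normalise. The scalar \<open>c\<close> is the normalising factor of
  \<open>v\<close>.\<close>

lemma unitary_mat_with_first_col:
  fixes v :: "complex vec"
  assumes v: "v \<in> carrier_vec n" and v0: "v \<noteq> 0\<^sub>v n" and n: "0 < n"
  obtains W c where "unitary_mat n W" "col W 0 = c \<cdot>\<^sub>v v"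
proof -
  interpret cof_vec_space n "TYPE(complex)" .
  note b = basis_completion[OF v v0]
  define ws where "ws = gram_schmidt n (basis_completion v)"
  obtain vs where bv: "basis_completion v = v # vs"
    using b(6,7) n by (cases "basis_completion v") auto
  have hd: "hd ws = v" unfolding ws_def bv by (rule gram_schmidt_hd[OF v])
  have ws: "set ws \<subseteq> carrier_vec n" "corthogonal ws" "length ws = n"
    using gram_schmidt_result[OF b(2,4,5) ws_def] b(6) by auto
  \<comment> \<open>The reciprocal norm of the \<open>i\<close>-th vector, written with
    \<open>csqrt\<close> because the inner product has complex type.\<close>
  define r where "r i = inverse (csqrt (ws ! i \<bullet>c ws ! i))" for i
  have wsi: "ws ! i \<in> carrier_vec n" if "i < n" for i using ws that by auto
  define W where "W = mat n n (\<lambda>(k, i). r i * ws ! i $ k)"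
  have W: "W \<in> carrier_mat n n" by (simp add: W_def)
  have colW: "col W i = r i \<cdot>\<^sub>v ws ! i" if "i < n" for i
    using that wsi[OF that] by (intro eq_vecI) (auto simp: W_def)
  have 1: "mat_adjoint W * W = 1\<^sub>m n"
  proof (intro eq_matI)
    fix i j assume "i < dim_row (1\<^sub>m n :: complex mat)" "j < dim_col (1\<^sub>m n :: complex mat)"
    then have ij: "i < n" "j < n" by auto
    have "(mat_adjoint W * W) $$ (i, j) = conjugate (col W i) \<bullet> col W j"
      using ij W by (simp add: row_mat_adjoint)
    also have "\<dots> = cnj (r i) * r j * (ws ! j \<bullet>c ws ! i)"
      unfolding colW[OF ij(1)] colW[OF ij(2)] conjugate_smult_vec
      using wsi[OF ij(1)] wsi[OF ij(2)]
      by (simp add: conjugate_vec_sprod_comm[of _ n] smult_scalar_prod_distrib[of _ n]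
          scalar_prod_smult_distrib[of _ n])
    also have "\<dots> = (if i = j then 1 else 0)"
    proof (cases "i = j")
      case True
      define z where "z = ws ! i \<bullet>c ws ! i"
      have z0: "z \<noteq> 0" using corthogonalD[OF ws(2), of i i] ij ws(3) by (simp add: z_def)
      \<comment> \<open>As \<open>z\<close> is real and nonnegative, its complex square root is
        real, so the conjugation on one factor \<open>r i\<close> is harmless and the two factors
        multiply to the inverse of \<open>z\<close>.\<close>
      have "0 \<le> z" unfolding z_def by (rule conjugate_square_ge_0_vec)
      then obtain x where x: "z = complex_of_real x" "0 \<le> x"
        by (cases z) (auto simp: less_eq_complex_def complex_of_real_def)
      then have "csqrt z = complex_of_real (sqrt x)" by simp
      moreover have "complex_of_real (sqrt x) * complex_of_real (sqrt x) = z"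
        unfolding x(1) using x(2) by (simp flip: of_real_mult)
      ultimately have "csqrt z * csqrt z = z" "cnj (csqrt z) = csqrt z" by simp_all
      then show ?thesis
        using z0 by (simp add: r_def True[symmetric] flip: z_def) (simp add: field_simps)
    next
      case False
      then show ?thesis using corthogonalD[OF ws(2), of j i] ij ws(3) by auto
    qed
    finally show "(mat_adjoint W * W) $$ (i, j) = 1\<^sub>m n $$ (i, j)" using ij by simp
  qed (use W in auto)
  moreover have "W * mat_adjoint W = 1\<^sub>m n"
    using W by (intro mat_mult_left_right_inverse[OF _ _ 1]) (auto intro: mat_adjoint_carrier)
  ultimately have "unitary_mat n W" using W by (auto simp: unitary_mat_def)
  moreover have "col W 0 = r 0 \<cdot>\<^sub>v v"
    using colW[OF n] hd ws(3) n by (cases ws) auto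
  ultimately show ?thesis by (rule that)
qed

section \<open>Functional calculus and singular values in a fixed eigenbasis\<close>

text \<open>For a fixed unitary \<open>U\<close> these matrices are closed under products and
  \<open>mat_fun\<close>, and both act pointwise on \<open>h\<close>. Matrix identities thus become
  identities between real functions of the index.\<close>

definition unitary_diag :: "nat \<Rightarrow> complex mat \<Rightarrow> (nat \<Rightarrow> real) \<Rightarrow> complex mat" where
  "unitary_diag n U h = U * mat_diag n (\<lambda>i. complex_of_real (h i)) * mat_adjoint U"

lemma mat_adjoint_mat_diag:
  "mat_adjoint (mat_diag n (\<lambda>i. complex_of_real (h i))) = mat_diag n (\<lambda>i. complex_of_real (h i))"
  by (intro eq_matI) (auto simp: mat_diag_def)

context
  fixes n :: nat and U :: "complex mat"
  assumes unitary: "unitary_mat n U"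
begin

lemma unitary_matD:
  "U \<in> carrier_mat n n" "mat_adjoint U \<in> carrier_mat n n"
  "mat_adjoint U * U = 1\<^sub>m n" "U * mat_adjoint U = 1\<^sub>m n"
  using unitary by (auto simp: unitary_mat_def intro: mat_adjoint_carrier)

lemma unitary_diag_carrier: "unitary_diag n U h \<in> carrier_mat n n"
  using unitary_matD(1,2) by (auto simp: unitary_diag_def intro!: mult_carrier_mat[of _ n n])

lemma unitary_diag_cong:
  "(\<And>i. i < n \<Longrightarrow> h i = k i) \<Longrightarrow> unitary_diag n U h = unitary_diag n U k"
  unfolding unitary_diag_def mat_diag_def
  by (intro arg_cong2[where f = "(*)"] cong_mat refl) auto

lemma unitary_diag_mult:
  "unitary_diag n U h * unitary_diag n U k = unitary_diag n U (\<lambda>i. h i * k i)"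
proof -
  let ?D = "\<lambda>h. mat_diag n (\<lambda>i. complex_of_real (h i))"
  note C = unitary_matD(1,2) mat_diag_dim[of n]
  have "unitary_diag n U h * unitary_diag n U k
      = U * (?D h * ((mat_adjoint U * U) * (?D k * mat_adjoint U)))"
    using C by (simp add: unitary_diag_def assoc_mult_mat[of _ n n _ n _ n] mult_carrier_mat[of _ n n])
  also have "\<dots> = U * ((?D h * ?D k) * mat_adjoint U)"
    unfolding unitary_matD(3)
    using C by (simp add: assoc_mult_mat[of _ n n _ n _ n] mult_carrier_mat[of _ n n]
        left_mult_one_mat[of _ n n] del: mat_diag_diag)
  also have "\<dots> = unitary_diag n U (\<lambda>i. h i * k i)"
    using C by (simp add: unitary_diag_def assoc_mult_mat[of _ n n _ n _ n] mult_carrier_mat[of _ n n])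
  finally show ?thesis .
qed

lemma mat_adjoint_unitary_diag: "mat_adjoint (unitary_diag n U h) = unitary_diag n U h"
  using unitary_matD(1,2) mat_diag_dim[of n]
  by (simp add: unitary_diag_def mat_adjoint_mult[of _ n n _ n] mult_carrier_mat[of _ n n]
      mat_adjoint_mat_diag assoc_mult_mat[of _ n n _ n _ n])

lemma spectral_decomposition_unitary_diag: "spectral_decomposition (unitary_diag n U h) U h"
  using unitary unitary_diag_carrier[of h] by (auto simp: spectral_decomposition_def unitary_diag_def)

lemma mat_fun_unitary_diag: "mat_fun f (unitary_diag n U h) = unitary_diag n U (\<lambda>i. f (h i))"
  using mat_fun_eq[OF spectral_decomposition_unitary_diag, of f h] unitary_diag_carrier[of h]
  unfolding unitary_diag_def by (metis carrier_matD(1))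

lemma char_poly_unitary_diag:
  "char_poly (unitary_diag n U h) = (\<Prod>x\<leftarrow>map h [0..<n]. [:- complex_of_real x, 1:])"
proof -
  let ?D = "mat_diag n (\<lambda>i. complex_of_real (h i))"
  have "similar_mat (unitary_diag n U h) ?D"
    using unitary_matD unitary_diag_carrier
    by (intro similar_matI[of _ _ U "mat_adjoint U" n]) (auto simp: unitary_diag_def)
  then have "char_poly (unitary_diag n U h) = char_poly ?D" by (rule char_poly_similar)
  also have "\<dots> = (\<Prod>x\<leftarrow>diag_mat ?D. [:- x, 1:])"
    by (rule char_poly_upper_triangular[of _ n]) (auto simp: mat_diag_def)
  also have "diag_mat ?D = map (\<lambda>i. complex_of_real (h i)) [0..<n]"
    by (auto simp: diag_mat_def mat_diag_def)
  finally show ?thesis by (simp add: o_def)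
qed

text \<open>For nonnegative \<open>h\<close> the matrix is its own absolute value, because the
  square root of \<open>h i * h i\<close> is \<open>h i\<close>. Its singular values are then the
  roots of a characteristic polynomial that is already factored.\<close>

lemma singular_value_unitary_diag:
  assumes h: "\<And>i. i < n \<Longrightarrow> 0 \<le> h i"
  shows "singular_value (unitary_diag n U h) j = rev (sort (map h [0..<n])) ! (j - 1)"
proof -
  have proots: "proots (\<Prod>x\<leftarrow>xs. [:- complex_of_real x, 1:]) = mset (map complex_of_real xs)" for xs
  proof (induction xs)
    case (Cons x xs)
    \<comment> \<open>Root multisets add up under products of nonzero polynomials.\<close>
    have "(\<Prod>x\<leftarrow>xs. [:- complex_of_real x, 1:]) \<noteq> 0" by (auto simp: prod_list_zero_iff)
    then show ?case using Cons by (simp add: proots_mult del: mult_pCons_left)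
  qed simp
  have "mat_abs (unitary_diag n U h) = unitary_diag n U (\<lambda>i. sqrt (h i * h i))"
    by (simp add: mat_abs_def mat_adjoint_unitary_diag unitary_diag_mult mat_fun_unitary_diag)
  also have "\<dots> = unitary_diag n U h" using h by (intro unitary_diag_cong) simp
  finally show ?thesis
    unfolding singular_value_def
    by (simp only: char_poly_unitary_diag proots mset_map[symmetric] sorted_list_of_multiset_mset)
      (simp add: o_def)
qed

text \<open>The quadratic form is tested on column \<open>i\<close> of \<open>U\<close>, a unit
  eigenvector for \<open>h i\<close>: its value there is the diagonal entry \<open>(i, i)\<close> of
  the matrix conjugated back by \<open>U\<close>, which is \<open>h i\<close>.\<close>

lemma positive_semidefinite_unitary_diagD:
  assumes psd: "positive_semidefinite n (unitary_diag n U h)" and i: "i < n"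
  shows "0 \<le> h i"
proof -
  let ?A = "unitary_diag n U h" and ?D = "mat_diag n (\<lambda>i. complex_of_real (h i))"
  note C = unitary_matD(1,2) unitary_diag_carrier[of h] mat_diag_dim[of n]
  have x: "col U i \<in> carrier_vec n" using C(1) i by (auto intro: col_carrier_vec)
  have "mat_adjoint U * (?A * U) = (mat_adjoint U * U) * ?D * (mat_adjoint U * U)"
    using C by (simp add: unitary_diag_def assoc_mult_mat[of _ n n _ n _ n] mult_carrier_mat[of _ n n])
  also have "\<dots> = ?D"
    unfolding unitary_matD(3) using C by (simp add: left_mult_one_mat[of _ n n] right_mult_one_mat[of _ n n])
  finally have "complex_of_real (h i) = (mat_adjoint U * (?A * U)) $$ (i, i)"
    using i by (simp add: mat_diag_def)
  also have "\<dots> = conjugate (col U i) \<bullet> (?A *\<^sub>v col U i)"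
    using C i by (simp add: row_mat_adjoint mult_mat_vec_def)
  also have "\<dots> = (?A *\<^sub>v col U i) \<bullet>c col U i"
    using C x by (intro conjugate_vec_sprod_comm[of _ n, symmetric]) auto
  finally have "0 \<le> complex_of_real (h i)"
    using psd x by (simp add: positive_semidefinite_def)
  then show ?thesis by (simp add: less_eq_complex_def)
qed

end

subsection \<open>The spectral theorem\<close>

text \<open>The direct sum of the scalar \<open>c\<close> and \<open>M\<close>. It respects products
  and adjoints, so a diagonalisation in dimension \<open>m\<close> lifts to dimension
  \<open>Suc m\<close>.\<close>

definition scalar_block :: "nat \<Rightarrow> complex \<Rightarrow> complex mat \<Rightarrow> complex mat" where
  "scalar_block m c M = four_block_mat (mat 1 1 (\<lambda>_. c)) (0\<^sub>m 1 m) (0\<^sub>m m 1) M"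

lemma scalar_block_carrier: "M \<in> carrier_mat m m \<Longrightarrow> scalar_block m c M \<in> carrier_mat (Suc m) (Suc m)"
  by (auto simp: scalar_block_def)

lemma scalar_block_mult:
  assumes M: "M \<in> carrier_mat m m" and N: "N \<in> carrier_mat m m"
  shows "scalar_block m c M * scalar_block m c' N = scalar_block m (c * c') (M * N)"
proof -
  have "mat 1 1 (\<lambda>_. c) * mat 1 1 (\<lambda>_. c') = mat 1 1 (\<lambda>_. c * c')"
    by (intro eq_matI) (auto simp: scalar_prod_def)
  then show ?thesis
    unfolding scalar_block_def using M N mult_carrier_mat[OF M N]
    by (subst mult_four_block_mat[where ?nr1.0 = 1 and ?n1.0 = 1 and ?nc1.0 = 1 and
          ?nr2.0 = m and ?n2.0 = m and ?nc2.0 = m]) auto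
qed

lemma scalar_block_one: "scalar_block m 1 (1\<^sub>m m) = 1\<^sub>m (Suc m)"
  by (intro eq_matI) (auto simp: scalar_block_def)

lemma scalar_block_adjoint:
  "M \<in> carrier_mat m m \<Longrightarrow> mat_adjoint (scalar_block m c M) = scalar_block m (cnj c) (mat_adjoint M)"
  by (intro eq_matI) (auto simp: scalar_block_def)

text \<open>Induction by deflation: an eigenvector is made the first column of a unitary
  \<open>W\<close>. In that basis the first column vanishes below the diagonal, Hermitian symmetry
  clears the first row too, and the induction hypothesis diagonalises the remaining block.\<close>

theorem hermitian_unitary_diag:
  assumes "A \<in> carrier_mat n n" "mat_adjoint A = A"
  shows "\<exists>U d. unitary_mat n U \<and> A = unitary_diag n U d"
  using assms
proof (induction n arbitrary: A)
  case 0
  have "unitary_mat 0 (1\<^sub>m 0)" by (auto simp: unitary_mat_def)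
  moreover have "A = unitary_diag 0 (1\<^sub>m 0) (\<lambda>_. 0)"
    using 0 by (intro eq_matI) (auto simp: unitary_diag_def)
  ultimately show ?case by blast
next
  case (Suc m)
  let ?n = "Suc m"
  note A = Suc.prems
  \<comment> \<open>The characteristic polynomial splits over the complex numbers into
    \<open>Suc m\<close> linear factors, so at least one root exists.\<close>
  obtain es where es: "char_poly A = (\<Prod>a\<leftarrow>es. [:- a, 1:])" "length es = ?n"
    using char_poly_factorized[OF A(1)] by blast
  then obtain e es' where "es = e # es'" by (cases es) auto
  then have "poly (char_poly A) e = 0" by (simp add: es(1))
  then obtain v where "eigenvector A v e"
    using eigenvalue_root_char_poly[OF A(1)] by (auto simp: eigenvalue_def)
  then have v: "v \<in> carrier_vec ?n" "v \<noteq> 0\<^sub>v ?n" "A *\<^sub>v v = e \<cdot>\<^sub>v v"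
    using A(1) by (auto simp: eigenvector_def)
  obtain W c where W: "unitary_mat ?n W" and colW: "col W 0 = c \<cdot>\<^sub>v v"
    using unitary_mat_with_first_col[OF v(1,2)] by blast
  let ?W' = "mat_adjoint W"
  note C = unitary_matD[OF W] A(1)
  define B where "B = ?W' * A * W"
  have B: "B \<in> carrier_mat ?n ?n"
    unfolding B_def using C by (auto intro!: mult_carrier_mat[of _ ?n ?n])
  have hermB: "mat_adjoint B = B"
    using C(1,2,5) A(2) by (simp add: B_def mat_adjoint_mult[of _ ?n ?n _ ?n] mult_carrier_mat[of _ ?n ?n]
        assoc_mult_mat[of _ ?n ?n _ ?n _ ?n])
  have cnjB: "B $$ (j, i) = cnj (B $$ (i, j))" if "i < ?n" "j < ?n" for i j
    using arg_cong[OF hermB, of "\<lambda>M. M $$ (j, i)"] that B by simp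
  have A_eq: "A = W * B * ?W'"
  proof -
    have "W * B * ?W' = (W * ?W') * A * (W * ?W')"
      using C(1,2,5) by (simp add: B_def assoc_mult_mat[of _ ?n ?n _ ?n _ ?n] mult_carrier_mat[of _ ?n ?n])
    then show ?thesis using C by simp
  qed
  \<comment> \<open>Column 0 of \<open>W\<close> is an eigenvector for \<open>e\<close>, so column 0
    of \<open>B\<close> is \<open>e\<close> times column 0 of the identity.\<close>
  have B0: "B $$ (i, 0) = (if i = 0 then e else 0)" if i: "i < ?n" for i
  proof -
    have "B = ?W' * (A * W)"
      using C(1,2,5) by (simp add: B_def assoc_mult_mat[of _ ?n ?n _ ?n _ ?n])
    then have "B $$ (i, 0) = row ?W' i \<bullet> (A *\<^sub>v col W 0)"
      using C(1,2,5) i by (simp add: mult_mat_vec_def)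
    also have "A *\<^sub>v col W 0 = e \<cdot>\<^sub>v col W 0"
      unfolding colW using v A(1) by (simp add: mult_mat_vec smult_smult_assoc mult.commute)
    also have "row ?W' i \<bullet> (e \<cdot>\<^sub>v col W 0) = e * (?W' * W) $$ (i, 0)"
      using C(1,2) i by simp
    finally show ?thesis using C(3) i by simp
  qed
  \<comment> \<open>The eigenvalue \<open>e\<close> is a diagonal entry of the Hermitian matrix
    \<open>B\<close>, hence real.\<close>
  define r where "r = Re e"
  have e: "e = complex_of_real r"
    using cnjB[of 0 0] B0[of 0] by (simp add: r_def complex_eq_iff)
  define A' where "A' = mat m m (\<lambda>(i, j). B $$ (Suc i, Suc j))"
  have A': "A' \<in> carrier_mat m m" "mat_adjoint A' = A'"
    by (auto simp: A'_def intro!: eq_matI cnjB[symmetric])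
  obtain V d where V: "unitary_mat m V" and d: "A' = unitary_diag m V d"
    using Suc.IH[OF A'] by blast
  note CV = unitary_matD[OF V]
  define Z where "Z = scalar_block m 1 V"
  have Z: "unitary_mat ?n Z"
    unfolding unitary_mat_def Z_def
    using CV by (simp add: scalar_block_adjoint scalar_block_mult scalar_block_one scalar_block_carrier)
  \<comment> \<open>The new eigenvalue takes index 0 and those of the block move up by one.\<close>
  define d' where "d' = case_nat r d"
  have B_eq: "B = unitary_diag ?n Z d'"
  proof -
    let ?D = "mat_diag m (\<lambda>i. complex_of_real (d i))"
    have "mat_diag ?n (\<lambda>i. complex_of_real (d' i)) = scalar_block m e ?D"
      by (intro eq_matI) (auto simp: scalar_block_def mat_diag_def d'_def e split: nat.split)
    then have "unitary_diag ?n Z d' = scalar_block m e (V * ?D * mat_adjoint V)"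
      using CV mat_diag_dim[of m]
      by (simp add: unitary_diag_def Z_def scalar_block_adjoint scalar_block_mult mult_carrier_mat[of _ m m])
    also have "V * ?D * mat_adjoint V = A'" using d by (simp add: unitary_diag_def)
    also have "scalar_block m e A' = B"
    proof (intro eq_matI)
      fix i j assume "i < dim_row B" "j < dim_col B"
      then have ij: "i < ?n" "j < ?n" using B by auto
      \<comment> \<open>The first row is the conjugate of the first column.\<close>
      have "B $$ (0, j) = (if j = 0 then e else 0)"
        using cnjB[of j 0] B0[of j] ij by (simp add: e)
      then show "scalar_block m e A' $$ (i, j) = B $$ (i, j)"
        using ij B0[of i] by (cases i; cases j) (auto simp: A'_def scalar_block_def)
    qed (use B in \<open>auto simp: A'_def scalar_block_def\<close>)
    finally show ?thesis by simp
  qed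
  have "A = unitary_diag ?n (W * Z) d'"
    using C(1,2) unitary_matD(1,2)[OF Z] mat_diag_dim[of ?n]
    by (simp add: A_eq B_eq unitary_diag_def mat_adjoint_mult[of _ ?n ?n _ ?n]
        assoc_mult_mat[of _ ?n ?n _ ?n _ ?n] mult_carrier_mat[of _ ?n ?n])
  with unitary_mat_mult[OF W Z] show ?case by blast
qed

section \<open>From eigenvalues to the singular value inequality\<close>

lemma positive_semidefinite_unitary_diag:
  assumes "positive_semidefinite n A"
  obtains U d where "unitary_mat n U" "A = unitary_diag n U d" "\<And>i. i < n \<Longrightarrow> 0 \<le> d i"
  using assms hermitian_unitary_diag[of A n] positive_semidefinite_unitary_diagD
  unfolding positive_semidefinite_def by metis

theorem theorem5p4:
  fixes f g :: "real \<Rightarrow> real" and A B :: "complex mat" and n j :: nat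
  assumes "\<forall>t\<ge>0. f t \<ge> 0" and "\<forall>t\<ge>0. g t \<ge> 0"
    and "synchronous_on {0..} f g"
    and "positive_semidefinite n A" and "positive_semidefinite n B"
    and "1 \<le> j" and "j \<le> n"
  shows "f (singular_value A j) * g (singular_value A j)
           + singular_value (mat_fun f B * mat_fun g B) j
         \<ge> f (singular_value A j) * singular_value (mat_fun g B) n
           + singular_value (mat_fun f B) j * g (singular_value A j)"
proof -
  obtain U a where U: "unitary_mat n U" "A = unitary_diag n U a" "\<And>i. i < n \<Longrightarrow> 0 \<le> a i"
    using positive_semidefinite_unitary_diag[OF assms(4)] by blast
  obtain V b where V: "unitary_mat n V" "B = unitary_diag n V b" "\<And>i. i < n \<Longrightarrow> 0 \<le> b i"
    using positive_semidefinite_unitary_diag[OF assms(5)] by blast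
  define s where "s = singular_value A j"
  \<comment> \<open>Being one of the eigenvalues of \<open>A\<close>, \<open>s\<close> lies in the
    half-line on which \<open>f\<close> and \<open>g\<close> are nonnegative and
    synchronous.\<close>
  have "s \<in> set (map a [0..<n])"
    unfolding s_def U(2) using nth_rev_sort_mem[of j "map a [0..<n]"] assms(6,7)
    by (simp add: singular_value_unitary_diag[OF U(1,3)])
  then have s0: "0 \<le> s" using U(3) by auto
  have s: "0 \<le> f s" "0 \<le> g s" using s0 assms(1,2) by auto
  define gn where "gn = singular_value (mat_fun g B) n"
  have gn: "gn = rev (sort (map (\<lambda>i. g (b i)) [0..<n])) ! (n - 1)"
    unfolding gn_def V(2) mat_fun_unitary_diag[OF V(1)]
    using V(3) assms(2) by (simp add: singular_value_unitary_diag[OF V(1)])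
  have gn_le: "gn \<le> g (b i)" if "i < n" for i
    unfolding gn using nth_rev_sort_last_le[of "g (b i)" "map (\<lambda>i. g (b i)) [0..<n]"] that by simp
  \<comment> \<open>At \<open>x = s_j(f(B))\<close> this is the right-hand side of the claim minus
    \<open>f s * g s\<close>.\<close>
  define \<phi> where "\<phi> x = x * g s + f s * (gn - g s)" for x
  have "\<phi> (rev (sort (map (\<lambda>i. f (b i)) [0..<n])) ! (j - 1))
      \<le> rev (sort (map (\<lambda>i. f (b i) * g (b i)) [0..<n])) ! (j - 1)"
  proof (rule nth_rev_sort_mono)
    show "mono \<phi>" using s by (auto simp: \<phi>_def intro!: monoI mult_right_mono)
    fix i assume "i \<in> set [0..<n]"
    then have i: "i < n" by simp
    \<comment> \<open>Expanding bounds \<open>f (b i) * g (b i)\<close> below by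
      \<open>f (b i) * g s + f s * g (b i) - f s * g s\<close>; the middle term is then lowered to
      \<open>f s * gn\<close>.\<close>
    have "0 \<le> (f (b i) - f s) * (g (b i) - g s)"
      using assms(3) s0 V(3)[OF i] by (auto simp: synchronous_on_def)
    moreover have "f s * gn \<le> f s * g (b i)" using s(1) gn_le[OF i] by (rule mult_left_mono[rotated])
    ultimately show "\<phi> (f (b i)) \<le> f (b i) * g (b i)" by (simp add: \<phi>_def algebra_simps)
  qed (use assms(6,7) in auto)
  moreover have "rev (sort (map (\<lambda>i. f (b i)) [0..<n])) ! (j - 1) = singular_value (mat_fun f B) j"
    unfolding V(2) mat_fun_unitary_diag[OF V(1)]
    using V(3) assms(1) by (simp add: singular_value_unitary_diag[OF V(1)])
  \<comment> \<open>Both factors are diagonal in the same basis \<open>V\<close>, so their product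
    has the nonnegative eigenvalues \<open>f (b i) * g (b i)\<close>.\<close>
  moreover have "rev (sort (map (\<lambda>i. f (b i) * g (b i)) [0..<n])) ! (j - 1)
      = singular_value (mat_fun f B * mat_fun g B) j"
    unfolding V(2) mat_fun_unitary_diag[OF V(1)] unitary_diag_mult[OF V(1)]
    using V(3) assms(1,2) by (simp add: singular_value_unitary_diag[OF V(1)])
  ultimately show ?thesis
    unfolding \<phi>_def gn_def[symmetric] s_def[symmetric] by (simp add: algebra_simps)
qed

end
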